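(* Let $T_i\in\mathcal{B}_A(\mathcal{H})$ for $1\le i\le n$, let $\omega=e^{2\pi \mathrm{i}/n}$ (with $\mathrm{i}$ the imaginary unit), and let $\mathbb{T}_{lcirc}=\mathrm{lcirc}(T_1,\dots,T_n)$ be the left circulant operator matrix. Let $\mathbb{D}$ be the $n\times n$ operator matrix whose $(1,1)$ entry is $\sum_{i=1}^n T_i$, whose $(k,n+2-k)$ entry for $2\le k\le n$ is $\sum_{i=1}^n \omega^{(n+1-k)(1-i)}T_i$, and whose other entries are all $O$; that is, $$\mathbb{D}=\begin{bmatrix}\sum_{i=1}^n T_i & O & O & \cdots & O\\ O & O & O & \cdots & \sum_{i=1}^n\omega^{(n-1)(1-i)}T_i\\ \vdots & \vdots & & & \vdots\\ O & O & \sum_{i=1}^n\omega^{2(1-i)}T_i & \cdots & O\\ O & \sum_{i=1}^n\omega^{(1-i)}T_i & O & \cdots & O\end{bmatrix}.$$ Then $w_{\mathbb{A}}(\mathbb{T}_{lcirc})=w_{\mathbb{A}}(\mathbb{D})$.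
   Context: $\mathcal{H}$ is a complex Hilbert space with inner product $\langle\cdot,\cdot\rangle$, $\mathcal{B}(\mathcal{H})$ is the algebra of bounded linear operators on $\mathcal{H}$, and $A\in\mathcal{B}(\mathcal{H})$ is a fixed positive operator ($\langle Ax,x\rangle\ge 0$ for all $x$). Put $\langle x,y\rangle_A=\langle Ax,y\rangle$ and $\|x\|_A=\sqrt{\langle x,x\rangle_A}$. $\mathcal{B}_A(\mathcal{H})$ is the set of $T\in\mathcal{B}(\mathcal{H})$ admitting an $A$-adjoint, i.e. for which there is $X\in\mathcal{B}(\mathcal{H})$ with $AX=T^*A$ (equivalently $\mathcal{R}(T^*A)\subseteq\mathcal{R}(A)$). The $A$-numerical radius is $w_A(T)=\sup\{|\langle Tx,x\rangle_A|: x\in\mathcal{H},\ \|x\|_A=1\}$. $\mathbb{A}$ denotes the $n\times n$ block diagonal operator matrix on $\bigoplus_{i=1}^n\mathcal{H}$ all of whose diagonal entries are $A$, and $w_{\mathbb{A}}$ is the numerical radius defined in the same way with $\mathcal{H},A$ replaced by $\bigoplus_{i=1}^n\mathcal{H},\mathbb{A}$. The left circulant operator matrix $\mathrm{lcirc}(T_1,\dots,T_n)$ is the $n\times n$ operator matrix whose first row is $T_1,\dots,T_n$ and whose other rows are obtained by successive left-shift cyclic permutations: its $(j,k)$ entry is $T_m$ where $m\in\{1,\dots,n\}$ and $m\equiv j+k-1 \pmod n$. *)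

theory Defs
  imports "HOL-Analysis.Analysis" "HOL-Number_Theory.Cong"
begin

text \<open>
  Complex inner product spaces, with the inner product linear in the first argument.  The last
  axiom says that the norm is the one induced by the inner product; together with the norm axioms
  it contains positive definiteness.
\<close>

class complex_inner = real_normed_vector +
  fixes scaleC :: "complex \<Rightarrow> 'a \<Rightarrow> 'a" (infixr \<open>*\<^sub>C\<close> 75)
    and cinner :: "'a \<Rightarrow> 'a \<Rightarrow> complex"
  assumes scaleC_add_right: "c *\<^sub>C (x + y) = c *\<^sub>C x + c *\<^sub>C y"
    and scaleC_add_left: "(c + d) *\<^sub>C x = c *\<^sub>C x + d *\<^sub>C x"
    and scaleC_scaleC: "c *\<^sub>C d *\<^sub>C x = (c * d) *\<^sub>C x"
    and scaleR_scaleC: "r *\<^sub>R x = complex_of_real r *\<^sub>C x"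
    and cinner_commute: "cinner x y = cnj (cinner y x)"
    and cinner_add_left: "cinner (x + y) z = cinner x z + cinner y z"
    and cinner_scaleC_left: "cinner (c *\<^sub>C x) y = c * cinner x y"
    and cinner_norm: "cinner x x = complex_of_real ((norm x)\<^sup>2)"

class chilbert_space = complex_inner + complete_space

instantiation complex :: chilbert_space
begin

definition scaleC_complex :: "complex \<Rightarrow> complex \<Rightarrow> complex"
  where "scaleC_complex c x = c * x"

definition cinner_complex :: "complex \<Rightarrow> complex \<Rightarrow> complex"
  where "cinner_complex x y = x * cnj y"

instance
  by standard
    (auto simp: scaleC_complex_def cinner_complex_def algebra_simps scaleR_conv_of_real
      complex_norm_square simp flip: of_real_power)

end

text \<open>
  The Hilbert space direct sum of copies of one space indexed by a finite type.  The library norm on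
  vectors is already the Euclidean combination of the norms of the components.
\<close>

instantiation vec :: (complex_inner, finite) complex_inner
begin

definition scaleC_vec :: "complex \<Rightarrow> 'a ^ 'b \<Rightarrow> 'a ^ 'b"
  where "scaleC_vec c x = (\<chi> i. c *\<^sub>C (x $ i))"

definition cinner_vec :: "'a ^ 'b \<Rightarrow> 'a ^ 'b \<Rightarrow> complex"
  where "cinner_vec x y = (\<Sum>i\<in>UNIV. cinner (x $ i) (y $ i))"

instance
proof
  fix c d :: complex and r :: real and x y z :: "'a ^ 'b"
  show "c *\<^sub>C (x + y) = c *\<^sub>C x + c *\<^sub>C y"
    by (simp add: scaleC_vec_def vec_eq_iff scaleC_add_right)
  show "(c + d) *\<^sub>C x = c *\<^sub>C x + d *\<^sub>C x"
    by (simp add: scaleC_vec_def vec_eq_iff scaleC_add_left)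
  show "c *\<^sub>C d *\<^sub>C x = (c * d) *\<^sub>C x"
    by (simp add: scaleC_vec_def vec_eq_iff scaleC_scaleC)
  show "r *\<^sub>R x = complex_of_real r *\<^sub>C x"
    by (simp add: scaleC_vec_def vec_eq_iff scaleR_scaleC)
  show "cinner x y = cnj (cinner y x)"
    unfolding cinner_vec_def cnj_sum by (rule sum.cong[OF refl]) (rule cinner_commute)
  show "cinner (x + y) z = cinner x z + cinner y z"
    by (simp add: cinner_vec_def cinner_add_left sum.distrib)
  show "cinner (c *\<^sub>C x) y = c * cinner x y"
    by (simp add: cinner_vec_def scaleC_vec_def cinner_scaleC_left sum_distrib_left)
  show "cinner x x = complex_of_real ((norm x)\<^sup>2)"
    by (simp add: cinner_vec_def cinner_norm norm_vec_def L2_set_def sum_nonneg)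
qed

end

instance vec :: (chilbert_space, finite) chilbert_space ..

definition bounded_clinear :: "('a::complex_inner \<Rightarrow> 'b::complex_inner) \<Rightarrow> bool"
  where "bounded_clinear T \<longleftrightarrow> bounded_linear T \<and> (\<forall>c x. T (c *\<^sub>C x) = c *\<^sub>C T x)"

definition positive_op :: "('a::complex_inner \<Rightarrow> 'a) \<Rightarrow> bool"
  where "positive_op A \<longleftrightarrow> bounded_clinear A \<and> (\<forall>x. cinner (A x) x \<in> \<real>\<^sub>\<ge>\<^sub>0)"

text \<open>
  The Hilbert space adjoint; for a bounded operator on a Hilbert space it exists and is unique by
  the Riesz representation theorem.
\<close>

definition cadjoint :: "('a::chilbert_space \<Rightarrow> 'a) \<Rightarrow> 'a \<Rightarrow> 'a"
  where "cadjoint T = (THE S. bounded_clinear S \<and> (\<forall>x y. cinner (T x) y = cinner x (S y)))"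

definition has_A_adjoint :: "('a::chilbert_space \<Rightarrow> 'a) \<Rightarrow> ('a \<Rightarrow> 'a) \<Rightarrow> bool"
  where "has_A_adjoint A T \<longleftrightarrow> (\<exists>X. bounded_clinear X \<and> A \<circ> X = cadjoint T \<circ> A)"

definition B_A :: "('a::chilbert_space \<Rightarrow> 'a) \<Rightarrow> ('a \<Rightarrow> 'a) set"
  where "B_A A = {T. bounded_clinear T \<and> has_A_adjoint A T}"

definition A_inner :: "('a::complex_inner \<Rightarrow> 'a) \<Rightarrow> 'a \<Rightarrow> 'a \<Rightarrow> complex"
  where "A_inner A x y = cinner (A x) y"

text \<open>For positive \<open>A\<close> the value \<open>A_inner A x x\<close> is real, so \<open>Re\<close> only changes its type.\<close>

definition A_norm :: "('a::complex_inner \<Rightarrow> 'a) \<Rightarrow> 'a \<Rightarrow> real"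
  where "A_norm A x = sqrt (Re (A_inner A x x))"

definition A_numerical_radius :: "('a::complex_inner \<Rightarrow> 'a) \<Rightarrow> ('a \<Rightarrow> 'a) \<Rightarrow> real"
  where "A_numerical_radius A T = (SUP x\<in>{x. A_norm A x = 1}. cmod (A_inner A (T x) x))"

text \<open>Operator matrices and the operators they induce on the direct sum.\<close>

type_synonym ('a, 'n) opmat = "('a \<Rightarrow> 'a) ^ 'n ^ 'n"

definition opmat_apply :: "('a::complex_inner, 'n::finite) opmat \<Rightarrow> 'a ^ 'n \<Rightarrow> 'a ^ 'n"
  where "opmat_apply M x = (\<chi> j. \<Sum>k\<in>UNIV. (M $ j $ k) (x $ k))"

definition block_diag :: "('a::complex_inner \<Rightarrow> 'a) \<Rightarrow> ('a, 'n::finite) opmat"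
  where "block_diag A = (\<chi> j k. if j = k then A else (\<lambda>x. 0))"

text \<open>
  The positions of an operator matrix are elements of a finite index type with \<open>n\<close> elements.  A
  numbering \<open>\<nu>\<close> says which of them is the first, second, ..., \<open>n\<close>-th row (and column).
\<close>

definition numbering :: "('n::finite \<Rightarrow> nat) \<Rightarrow> bool"
  where "numbering \<nu> \<longleftrightarrow> bij_betw \<nu> UNIV {1..CARD('n)}"

definition lcirc :: "('n::finite \<Rightarrow> nat) \<Rightarrow> (nat \<Rightarrow> 'a \<Rightarrow> 'a) \<Rightarrow> ('a::complex_inner, 'n) opmat"
  where "lcirc \<nu> T =
    (\<chi> j k. T (THE m. m \<in> {1..CARD('n)} \<and> [m = \<nu> j + \<nu> k - 1] (mod CARD('n))))"

definition root_of_unity :: "nat \<Rightarrow> complex"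
  where "root_of_unity n = exp (2 * complex_of_real pi * \<i> / of_nat n)"

definition lcirc_D :: "('n::finite \<Rightarrow> nat) \<Rightarrow> (nat \<Rightarrow> 'a \<Rightarrow> 'a) \<Rightarrow> ('a::complex_inner, 'n) opmat"
  where "lcirc_D \<nu> T = (let n = CARD('n); \<omega> = root_of_unity n in
    \<chi> j k.
      if \<nu> j = 1 \<and> \<nu> k = 1 then (\<lambda>x. \<Sum>i=1..n. T i x)
      else if 2 \<le> \<nu> j \<and> \<nu> k = n + 2 - \<nu> j
        then (\<lambda>x. \<Sum>i=1..n. (\<omega> powi ((int n + 1 - int (\<nu> j)) * (1 - int i))) *\<^sub>C T i x)
      else (\<lambda>x. 0))"

end

theory Submission imports Defs begin

text \<open>
  The two operator matrices are unitarily equivalent, by a unitary with scalar entries.  Number rows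
  and columns by residues \<open>p, q\<close> modulo \<open>n\<close> (one less than in \<open>\<nu>\<close>) and put \<open>S\<^sub>r = T\<^sub>r\<^sub>+\<^sub>1\<close>.  The left
  circulant \<open>L\<close> has entry \<open>S\<close> with index \<open>p + q\<close> in position \<open>(p, q)\<close>, and the matrix \<open>D\<close> has entry
  \<open>\<Sum>r. \<omega>^(p r) S\<^sub>r\<close> where \<open>p + q = 0\<close> modulo \<open>n\<close> and \<open>0\<close> elsewhere.  Let \<open>U\<close> be the discrete Fourier
  transform with entries \<open>\<omega>^(- p q) / \<surd>n\<close>.  Substituting \<open>r = p + q\<close> in the circulant and
  \<open>b = - q\<close> in the transform shows that \<open>(L U x)\<^sub>p\<close> and \<open>(U D x)\<^sub>p\<close> both equal
  \<open>(\<Sum>b r. \<omega>^((p - r) b) S\<^sub>r x\<^sub>b) / \<surd>n\<close>, that is, \<open>L U = U D\<close> (\<open>lcirc_fourier\<close>).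

  The transform is unitary by the orthogonality of characters (\<open>fourier_inverse\<close>,
  \<open>cinner_fourier_left\<close>), and it commutes with the block diagonal operator because its entries are
  scalars (\<open>block_diag_fourier\<close>).  It therefore permutes the \<open>A\<close>-unit sphere and carries the
  quadratic form of \<open>D\<close> to that of the circulant, so that the two numerical radii are suprema of
  the same set (\<open>A_numerical_radius_unitarily_equivalent\<close>).
\<close>

section \<open>Complex inner products\<close>

lemma scaleC_one [simp]: "1 *\<^sub>C x = (x :: 'a::complex_inner)"
  using scaleR_scaleC[of 1 x] by simp

lemma scaleC_zero_left [simp]: "0 *\<^sub>C x = (0 :: 'a::complex_inner)"
  using scaleR_scaleC[of 0 x] by simp

lemma scaleC_zero_right [simp]: "c *\<^sub>C (0 :: 'a::complex_inner) = 0"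
  using scaleC_scaleC[of c 0 "0::'a"] by simp

lemma scaleC_sum_right:
  "c *\<^sub>C (\<Sum>i\<in>I. f i) = (\<Sum>i\<in>I. c *\<^sub>C (f i :: 'a::complex_inner))"
  by (induction I rule: infinite_finite_induct) (simp_all add: scaleC_add_right)

lemma scaleC_sum_left:
  "(\<Sum>i\<in>I. f i) *\<^sub>C x = (\<Sum>i\<in>I. f i *\<^sub>C (x :: 'a::complex_inner))"
  by (induction I rule: infinite_finite_induct) (simp_all add: scaleC_add_left)

lemma cinner_zero_left [simp]: "cinner 0 (y :: 'a::complex_inner) = 0"
  using cinner_scaleC_left[of 0 0 y] by simp

lemma cinner_sum_left:
  "cinner (\<Sum>i\<in>I. f i) y = (\<Sum>i\<in>I. cinner (f i) (y :: 'a::complex_inner))"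
  by (induction I rule: infinite_finite_induct) (simp_all add: cinner_add_left)

lemma cinner_sum_right:
  "cinner y (\<Sum>i\<in>I. f i) = (\<Sum>i\<in>I. cinner (y :: 'a::complex_inner) (f i))"
proof -
  have "cinner y (\<Sum>i\<in>I. f i) = cnj (\<Sum>i\<in>I. cinner (f i) y)"
    by (subst cinner_commute) (simp add: cinner_sum_left)
  also have "\<dots> = (\<Sum>i\<in>I. cinner y (f i))"
    unfolding cnj_sum by (rule sum.cong[OF refl]) (rule cinner_commute[symmetric])
  finally show ?thesis .
qed

lemma cinner_scaleC_right:
  "cinner x (c *\<^sub>C y) = cnj c * cinner x (y :: 'a::complex_inner)"
proof -
  have "cinner x (c *\<^sub>C y) = cnj (c * cinner y x)"
    by (subst cinner_commute) (simp add: cinner_scaleC_left)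
  also have "\<dots> = cnj c * cinner x y"
    using cinner_commute[of x y] by simp
  finally show ?thesis .
qed

lemma bounded_clinear_sum:
  "bounded_clinear T \<Longrightarrow> T (\<Sum>i\<in>I. f i) = (\<Sum>i\<in>I. T (f i))"
  by (simp add: bounded_clinear_def linear_sum bounded_linear.linear)

lemma bounded_clinear_scaleC: "bounded_clinear T \<Longrightarrow> T (c *\<^sub>C x) = c *\<^sub>C T x"
  by (simp add: bounded_clinear_def)

lemma opmat_apply_block_diag: "opmat_apply (block_diag A) x $ j = A (x $ j)"
proof -
  have "opmat_apply (block_diag A) x $ j = (\<Sum>k\<in>UNIV. if j = k then A (x $ k) else 0)"
    unfolding opmat_apply_def block_diag_def vec_lambda_beta by (rule sum.cong) auto
  then show ?thesis by simp
qed

section \<open>Invariance of the numerical radius under unitary equivalence\<close>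

text \<open>
  A unitary that commutes with \<open>A\<close> is also unitary for the semi-inner product of \<open>A\<close>, hence maps
  the \<open>A\<close>-unit sphere onto itself, and the two suprema range over the same set of values.
\<close>

lemma A_numerical_radius_unitarily_equivalent:
  fixes A L D U :: "'a::complex_inner \<Rightarrow> 'a"
  assumes surj: "surj U"
    and isometry: "\<And>x y. cinner (U x) (U y) = cinner x y"
    and commute: "\<And>x. A (U x) = U (A x)"
    and intertwine: "\<And>x. L (U x) = U (D x)"
  shows "A_numerical_radius A L = A_numerical_radius A D"
proof -
  have inner: "A_inner A (U x) (U y) = A_inner A x y" for x y
    by (simp add: A_inner_def commute isometry)
  have "{x. A_norm A x = 1} = U ` {x. A_norm A x = 1}"
  proof (intro equalityI subsetI)
    fix y assume y: "y \<in> {x. A_norm A x = 1}"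
    obtain x where "y = U x" using surj by (metis surjD)
    with y show "y \<in> U ` {x. A_norm A x = 1}"
      by (auto simp: A_norm_def inner)
  qed (auto simp: A_norm_def inner)
  then have "A_numerical_radius A L
      = (SUP x\<in>U ` {x. A_norm A x = 1}. cmod (A_inner A (L x) x))"
    unfolding A_numerical_radius_def by simp
  also have "\<dots> = A_numerical_radius A D"
    unfolding A_numerical_radius_def image_image intertwine inner ..
  finally show ?thesis .
qed

section \<open>Sums over residues and the characters of the cyclic group\<close>

text \<open>
  Periodicity is expressed by invariance under reduction modulo \<open>n\<close>; such a function may be summed
  over any complete system of residues.
\<close>

lemma sum_residues_shift:
  fixes f :: "int \<Rightarrow> 'b::comm_monoid_add"
  assumes "n > 0" and "\<And>m. f (m mod n) = f m"
  shows "(\<Sum>r\<in>{0..<n}. f (r + c)) = (\<Sum>r\<in>{0..<n}. f r)"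
  using assms
  by (intro sum.reindex_bij_witness[where i = "\<lambda>r. (r - c) mod n" and j = "\<lambda>r. (r + c) mod n"])
    (auto simp: mod_simps)

lemma sum_residues_reflect:
  fixes f :: "int \<Rightarrow> 'b::comm_monoid_add"
  assumes "n > 0" and "\<And>m. f (m mod n) = f m"
  shows "(\<Sum>r\<in>{0..<n}. f (- r)) = (\<Sum>r\<in>{0..<n}. f r)"
  using assms
  by (intro sum.reindex_bij_witness[where i = "\<lambda>r. (- r) mod n" and j = "\<lambda>r. (- r) mod n"])
    (auto simp: mod_simps)

definition character :: "nat \<Rightarrow> int \<Rightarrow> complex"
  where "character n m = cis (2 * pi * of_int m / of_nat n)"

lemma root_of_unity_powi: "root_of_unity n powi m = character n m"
proof -
  have "root_of_unity n = cis (2 * pi / of_nat n)"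
    unfolding root_of_unity_def cis_conv_exp by (simp add: mult_ac)
  then show ?thesis
    unfolding character_def by (simp add: cis_power_int mult_ac)
qed

lemma character_add: "character n (a + b) = character n a * character n b"
  unfolding character_def by (simp add: cis_mult add_divide_distrib distrib_left)

lemma character_zero [simp]: "character n 0 = 1"
  by (simp add: character_def)

lemma cnj_character: "cnj (character n m) = character n (- m)"
  by (simp add: character_def cis_cnj)

lemma character_eq_1_iff:
  assumes "n > 0"
  shows "character n m = 1 \<longleftrightarrow> int n dvd m"
proof -
  have "character n m = 1 \<longleftrightarrow> (\<exists>k::int. 2 * pi * of_int m / of_nat n = of_int (2 * k) * pi)"
    unfolding character_def cis_conv_exp exp_eq_1 by simp
  also have "\<dots> \<longleftrightarrow> (\<exists>k::int. real_of_int m = real_of_int (int n * k))"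
    using assms by (auto simp: field_simps)
  also have "\<dots> \<longleftrightarrow> int n dvd m"
    unfolding of_int_eq_iff dvd_def ..
  finally show ?thesis .
qed

lemma character_cong:
  assumes "n > 0" and "a mod int n = b mod int n"
  shows "character n a = character n b"
proof -
  have "character n (a - b) = 1"
    using assms by (simp add: character_eq_1_iff mod_eq_dvd_iff)
  then show ?thesis using character_add[of n "a - b" b] by simp
qed

text \<open>
  Orthogonality of the characters: replacing \<open>r\<close> by \<open>r + 1\<close> permutes the residues and multiplies
  the sum by \<open>character n m\<close>, so the sum vanishes unless that factor is \<open>1\<close>.
\<close>

lemma sum_character:
  assumes "n > 0"
  shows "(\<Sum>r\<in>{0..<int n}. character n (m * r)) = (if int n dvd m then of_nat n else 0)"
proof (cases "int n dvd m")
  case True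
  then have "character n (m * r) = 1" for r
    using assms by (simp add: character_eq_1_iff)
  with True show ?thesis by simp
next
  case False
  let ?s = "\<Sum>r\<in>{0..<int n}. character n (m * r)"
  have "?s = (\<Sum>r\<in>{0..<int n}. character n (m * (r + 1)))"
    using assms
    by (intro sum_residues_shift[symmetric] character_cong) (auto simp: mod_simps)
  also have "\<dots> = character n m * ?s"
    by (simp add: sum_distrib_left character_add distrib_left mult_ac)
  finally have "(character n m - 1) * ?s = 0"
    by (simp add: algebra_simps)
  then show ?thesis
    using False assms by (simp add: character_eq_1_iff)
qed

section \<open>Vectors as periodic sequences\<close>

definition pos :: "('n::finite \<Rightarrow> nat) \<Rightarrow> 'n \<Rightarrow> int"
  where "pos \<nu> j = int (\<nu> j) - 1"

text \<open>
  The entries of a vector, extended periodically to all integer positions.  Index shifts and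
  reflections modulo \<open>n\<close> become ordinary integer arithmetic.
\<close>

definition periodic_seq :: "('n::finite \<Rightarrow> nat) \<Rightarrow> 'a ^ 'n \<Rightarrow> int \<Rightarrow> 'a"
  where "periodic_seq \<nu> x m = x $ inv_into UNIV (pos \<nu>) (m mod int CARD('n))"

lemma bij_betw_pos:
  fixes \<nu> :: "'n::finite \<Rightarrow> nat"
  assumes "numbering \<nu>"
  shows "bij_betw (pos \<nu>) UNIV {0..<int CARD('n)}"
proof -
  have "bij_betw (\<lambda>m. int m - 1) {1..CARD('n)} {0..<int CARD('n)}"
    by (rule bij_betw_byWitness[where f' = "\<lambda>r. nat (r + 1)"]) auto
  then have "bij_betw ((\<lambda>m. int m - 1) \<circ> \<nu>) UNIV {0..<int CARD('n)}"
    using assms bij_betw_trans unfolding numbering_def by blast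
  moreover have "(\<lambda>m. int m - 1) \<circ> \<nu> = pos \<nu>"
    by (auto simp: pos_def)
  ultimately show ?thesis by simp
qed

lemma pos_bounds:
  fixes \<nu> :: "'n::finite \<Rightarrow> nat"
  assumes "numbering \<nu>"
  shows "0 \<le> pos \<nu> j" and "pos \<nu> j < int CARD('n)"
  using bij_betw_apply[OF bij_betw_pos[OF assms], of j] by auto

lemma pos_eq_iff:
  assumes "numbering \<nu>"
  shows "pos \<nu> j = pos \<nu> k \<longleftrightarrow> j = k"
  using bij_betw_imp_inj_on[OF bij_betw_pos[OF assms]] by (auto dest: injD)

lemma sum_pos:
  fixes \<nu> :: "'n::finite \<Rightarrow> nat"
  assumes "numbering \<nu>"
  shows "(\<Sum>k\<in>UNIV. f (pos \<nu> k)) = (\<Sum>q\<in>{0..<int CARD('n)}. f q)"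
  by (rule sum.reindex_bij_betw[OF bij_betw_pos[OF assms]])

lemma periodic_seq_mod:
  fixes x :: "'a ^ 'n::finite"
  shows "periodic_seq \<nu> x (m mod int CARD('n)) = periodic_seq \<nu> x m"
  by (simp add: periodic_seq_def)

lemma periodic_seq_pos:
  assumes "numbering \<nu>"
  shows "periodic_seq \<nu> x (pos \<nu> j) = x $ j"
  using bij_betw_imp_inj_on[OF bij_betw_pos[OF assms]] pos_bounds[OF assms, of j]
  by (simp add: periodic_seq_def)

text \<open>
  A formula in the position that is itself periodic needs checking only on the entries.
\<close>

lemma periodic_seq_eqI:
  fixes x :: "'a ^ 'n::finite"
  assumes "numbering \<nu>"
    and "\<And>m. f (m mod int CARD('n)) = f m"
    and "\<And>j. x $ j = f (pos \<nu> j)"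
  shows "periodic_seq \<nu> x m = f m"
proof -
  have "m mod int CARD('n) \<in> pos \<nu> ` UNIV"
    unfolding bij_betw_imp_surj_on[OF bij_betw_pos[OF assms(1)]] by simp
  then have "pos \<nu> (inv_into UNIV (pos \<nu>) (m mod int CARD('n))) = m mod int CARD('n)"
    by (rule f_inv_into_f)
  then show ?thesis
    by (simp add: periodic_seq_def assms)
qed

section \<open>The discrete Fourier transform\<close>

text \<open>
  The sign \<open>\<epsilon>\<close> selects between the transform and its inverse, so that one definition serves both.
\<close>

definition fourier :: "int \<Rightarrow> ('n::finite \<Rightarrow> nat) \<Rightarrow> 'a::complex_inner ^ 'n \<Rightarrow> 'a ^ 'n"
  where "fourier \<epsilon> \<nu> x = (\<chi> j. complex_of_real (1 / sqrt (real CARD('n))) *\<^sub>C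
    (\<Sum>k\<in>UNIV. character CARD('n) (\<epsilon> * pos \<nu> j * pos \<nu> k) *\<^sub>C (x $ k)))"

text \<open>
  The \<open>(j, l)\<close> entry of the product of the two scalar matrices is the mean of the character values
  at the multiples of \<open>\<epsilon> (pos \<nu> l - pos \<nu> j)\<close>, which orthogonality turns into a Kronecker delta.
\<close>

lemma fourier_inverse:
  fixes x :: "'a::complex_inner ^ 'n::finite"
  assumes \<nu>: "numbering \<nu>" and \<epsilon>: "\<bar>\<epsilon>\<bar> = 1"
  shows "fourier (- \<epsilon>) \<nu> (fourier \<epsilon> \<nu> x) = x"
proof -
  let ?n = "CARD('n)" and ?c = "complex_of_real (1 / sqrt (real CARD('n)))"
  have c: "?c * ?c = 1 / of_nat ?n"
    by (simp flip: of_real_mult)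
  have orthogonality: "(\<Sum>k\<in>UNIV. character ?n (- \<epsilon> * pos \<nu> j * pos \<nu> k)
      * character ?n (\<epsilon> * pos \<nu> k * pos \<nu> l)) = (if j = l then of_nat ?n else 0)"
    (is "?lhs = _") for j l
  proof -
    let ?m = "\<epsilon> * (pos \<nu> l - pos \<nu> j)"
    have "?lhs = (\<Sum>k\<in>UNIV. character ?n (?m * pos \<nu> k))"
      by (simp add: algebra_simps flip: character_add)
    also have "\<dots> = (if int ?n dvd ?m then of_nat ?n else 0)"
      by (simp add: sum_pos[OF \<nu>, where f = "\<lambda>q. character ?n (?m * q)"] sum_character)
    also have "int ?n dvd ?m \<longleftrightarrow> int ?n dvd pos \<nu> l - pos \<nu> j"
      using \<epsilon> by (simp add: dvd_mult_unit_iff' zdvd1_eq)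
    also have "\<dots> \<longleftrightarrow> pos \<nu> l = pos \<nu> j"
      using pos_bounds[OF \<nu>, of l] pos_bounds[OF \<nu>, of j]
      by (simp flip: mod_eq_dvd_iff)
    also have "\<dots> \<longleftrightarrow> j = l"
      by (auto simp: pos_eq_iff[OF \<nu>])
    finally show ?thesis .
  qed
  show ?thesis
  proof (rule vec_eq_iff[THEN iffD2, rule_format])
    fix j
    have "fourier (- \<epsilon>) \<nu> (fourier \<epsilon> \<nu> x) $ j
        = (\<Sum>k\<in>UNIV. \<Sum>l\<in>UNIV. (?c * ?c * (character ?n (- \<epsilon> * pos \<nu> j * pos \<nu> k)
            * character ?n (\<epsilon> * pos \<nu> k * pos \<nu> l))) *\<^sub>C (x $ l))"
      by (simp add: fourier_def scaleC_sum_right scaleC_scaleC mult_ac)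
    also have "\<dots> = (\<Sum>l\<in>UNIV. (?c * ?c * (\<Sum>k\<in>UNIV. character ?n (- \<epsilon> * pos \<nu> j * pos \<nu> k)
            * character ?n (\<epsilon> * pos \<nu> k * pos \<nu> l))) *\<^sub>C (x $ l))"
      by (subst sum.swap) (simp only: sum_distrib_left scaleC_sum_left)
    also have "\<dots> = (\<Sum>l\<in>UNIV. if l = j then x $ l else 0)"
      unfolding orthogonality c by (intro sum.cong) auto
    also have "\<dots> = x $ j" by simp
    finally show "fourier (- \<epsilon>) \<nu> (fourier \<epsilon> \<nu> x) $ j = x $ j" .
  qed
qed

lemma cinner_fourier_left:
  fixes x y :: "'a::complex_inner ^ 'n::finite"
  shows "cinner (fourier \<epsilon> \<nu> x) y = cinner x (fourier (- \<epsilon>) \<nu> y)"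
proof -
  let ?c = "complex_of_real (1 / sqrt (real CARD('n)))"
  have "cinner (fourier \<epsilon> \<nu> x) y = (\<Sum>j\<in>UNIV. \<Sum>k\<in>UNIV.
      ?c * (character CARD('n) (\<epsilon> * pos \<nu> j * pos \<nu> k) * cinner (x $ k) (y $ j)))"
    by (simp add: cinner_vec_def fourier_def cinner_scaleC_left cinner_sum_left sum_distrib_left)
  also have "\<dots> = (\<Sum>k\<in>UNIV. \<Sum>j\<in>UNIV.
      ?c * (character CARD('n) (\<epsilon> * pos \<nu> j * pos \<nu> k) * cinner (x $ k) (y $ j)))"
    by (rule sum.swap)
  also have "\<dots> = cinner x (fourier (- \<epsilon>) \<nu> y)"
    by (simp add: cinner_vec_def fourier_def cinner_scaleC_right cinner_sum_right
        sum_distrib_left cnj_character mult_ac)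
  finally show ?thesis .
qed

lemma block_diag_fourier:
  assumes "bounded_clinear A"
  shows "opmat_apply (block_diag A) (fourier \<epsilon> \<nu> x)
    = fourier \<epsilon> \<nu> (opmat_apply (block_diag A) x)"
  by (simp add: vec_eq_iff opmat_apply_block_diag fourier_def
      bounded_clinear_sum[OF assms] bounded_clinear_scaleC[OF assms])

lemma periodic_seq_fourier:
  fixes x :: "'a::complex_inner ^ 'n::finite"
  assumes \<nu>: "numbering \<nu>"
  shows "periodic_seq \<nu> (fourier \<epsilon> \<nu> x) m = complex_of_real (1 / sqrt (real CARD('n))) *\<^sub>C
    (\<Sum>q\<in>{0..<int CARD('n)}. character CARD('n) (\<epsilon> * m * q) *\<^sub>C periodic_seq \<nu> x q)"
proof (rule periodic_seq_eqI[OF \<nu>, where f = "\<lambda>m. _ m"])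
  fix m
  have "character CARD('n) (\<epsilon> * (m mod int CARD('n)) * q) = character CARD('n) (\<epsilon> * m * q)" for q
    by (rule character_cong) (simp, metis mod_mult_left_eq mod_mult_right_eq)
  then show "complex_of_real (1 / sqrt (real CARD('n))) *\<^sub>C (\<Sum>q\<in>{0..<int CARD('n)}.
        character CARD('n) (\<epsilon> * (m mod int CARD('n)) * q) *\<^sub>C periodic_seq \<nu> x q)
      = complex_of_real (1 / sqrt (real CARD('n))) *\<^sub>C (\<Sum>q\<in>{0..<int CARD('n)}.
        character CARD('n) (\<epsilon> * m * q) *\<^sub>C periodic_seq \<nu> x q)"
    by simp
next
  fix j
  show "fourier \<epsilon> \<nu> x $ j = complex_of_real (1 / sqrt (real CARD('n))) *\<^sub>C
    (\<Sum>q\<in>{0..<int CARD('n)}. character CARD('n) (\<epsilon> * pos \<nu> j * q) *\<^sub>C periodic_seq \<nu> x q)"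
    by (simp add: fourier_def periodic_seq_pos[OF \<nu>] flip: sum_pos[OF \<nu>])
qed

section \<open>Circulant matrices in terms of periodic sequences\<close>

text \<open>
  The shift by one makes position \<open>0\<close> correspond to the first operator \<open>T 1\<close>.  For
  positive \<open>n\<close> the values are exactly \<open>T 1, \<dots>, T n\<close>.
\<close>

definition periodic_ops :: "nat \<Rightarrow> (nat \<Rightarrow> 'b) \<Rightarrow> int \<Rightarrow> 'b"
  where "periodic_ops n T m = T (nat (m mod int n) + 1)"

lemma periodic_ops_mod: "periodic_ops n T (m mod int n) = periodic_ops n T m"
  by (simp add: periodic_ops_def)

lemma lcirc_entry:
  fixes \<nu> :: "'n::finite \<Rightarrow> nat"
  assumes \<nu>: "numbering \<nu>"
  shows "lcirc \<nu> T $ j $ k = periodic_ops CARD('n) T (pos \<nu> j + pos \<nu> k)"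
proof -
  let ?n = "CARD('n)" and ?m = "nat ((pos \<nu> j + pos \<nu> k) mod int CARD('n)) + 1"
  have \<nu>1: "\<nu> j \<ge> 1" "\<nu> k \<ge> 1"
    using pos_bounds[OF \<nu>, of j] pos_bounds[OF \<nu>, of k] by (auto simp: pos_def)
  have eq: "[m = \<nu> j + \<nu> k - 1] (mod ?n) \<longleftrightarrow>
      (int m - 1) mod int ?n = (pos \<nu> j + pos \<nu> k) mod int ?n" for m
  proof -
    have "[m = \<nu> j + \<nu> k - 1] (mod ?n) \<longleftrightarrow> [int m = pos \<nu> j + pos \<nu> k + 1] (mod int ?n)"
      using \<nu>1 by (simp add: pos_def of_nat_diff add_ac flip: cong_int_iff)
    also have "\<dots> \<longleftrightarrow> int ?n dvd int m - 1 - (pos \<nu> j + pos \<nu> k)"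
      by (simp add: cong_iff_dvd_diff algebra_simps)
    finally show ?thesis by (simp add: mod_eq_dvd_iff)
  qed
  have "(THE m. m \<in> {1..?n} \<and> [m = \<nu> j + \<nu> k - 1] (mod ?n)) = ?m"
  proof (rule the_equality)
    have "nat ((pos \<nu> j + pos \<nu> k) mod int ?n) < ?n"
      by (simp add: nat_less_iff)
    then show "?m \<in> {1..?n} \<and> [?m = \<nu> j + \<nu> k - 1] (mod ?n)"
      unfolding eq by auto
  next
    fix m assume m: "m \<in> {1..?n} \<and> [m = \<nu> j + \<nu> k - 1] (mod ?n)"
    then have "(int m - 1) mod int ?n = int m - 1" by auto
    with m show "m = ?m" unfolding eq by auto
  qed
  then show ?thesis
    by (simp add: lcirc_def periodic_ops_def)
qed

text \<open>
  An entry depends only on \<open>r = p + q\<close>, so a row of the circulant acts as a correlation of the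
  operator sequence with the vector.
\<close>

lemma opmat_apply_lcirc:
  fixes x :: "'a::complex_inner ^ 'n::finite"
  assumes \<nu>: "numbering \<nu>"
  shows "opmat_apply (lcirc \<nu> T) x $ j
    = (\<Sum>r\<in>{0..<int CARD('n)}. periodic_ops CARD('n) T r (periodic_seq \<nu> x (r - pos \<nu> j)))"
proof -
  let ?n = "CARD('n)"
  let ?f = "\<lambda>r. periodic_ops ?n T r (periodic_seq \<nu> x (r - pos \<nu> j))"
  have "opmat_apply (lcirc \<nu> T) x $ j = (\<Sum>k\<in>UNIV. ?f (pos \<nu> k + pos \<nu> j))"
    by (simp add: opmat_apply_def lcirc_entry[OF \<nu>] periodic_seq_pos[OF \<nu>] add_ac)
  also have "\<dots> = (\<Sum>q\<in>{0..<int ?n}. ?f (q + pos \<nu> j))"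
    by (rule sum_pos[OF \<nu>])
  also have "\<dots> = (\<Sum>r\<in>{0..<int ?n}. ?f r)"
  proof (rule sum_residues_shift)
    fix m
    have "periodic_seq \<nu> x (m mod int ?n - pos \<nu> j) = periodic_seq \<nu> x (m - pos \<nu> j)"
      by (metis mod_diff_left_eq periodic_seq_mod)
    then show "?f (m mod int ?n) = ?f m"
      by (simp add: periodic_ops_mod)
  qed simp
  finally show ?thesis .
qed

text \<open>
  The two cases in the definition of the matrix are the two ways in which the positions, both in
  \<open>{0..<n}\<close>, can add up to a multiple of \<open>n\<close>: the sum is \<open>0\<close> in the corner and \<open>n\<close> on the
  antidiagonal.  With \<open>r = i - 1\<close> and \<open>p = pos \<nu> j\<close> the exponent \<open>(n - p) (- r)\<close> is congruent to
  \<open>p r\<close> modulo \<open>n\<close>.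
\<close>

lemma lcirc_D_entry:
  fixes \<nu> :: "'n::finite \<Rightarrow> nat" and T :: "nat \<Rightarrow> 'a \<Rightarrow> 'a::complex_inner"
  assumes \<nu>: "numbering \<nu>"
  shows "(lcirc_D \<nu> T $ j $ k) x =
    (if int CARD('n) dvd pos \<nu> j + pos \<nu> k
     then \<Sum>r\<in>{0..<int CARD('n)}. character CARD('n) (pos \<nu> j * r) *\<^sub>C periodic_ops CARD('n) T r x
     else 0)"
proof -
  let ?n = "CARD('n)"
  let ?S = "\<Sum>r\<in>{0..<int ?n}. character ?n (pos \<nu> j * r) *\<^sub>C periodic_ops ?n T r x"
  have bounds: "0 \<le> pos \<nu> j" "pos \<nu> j < int ?n" "0 \<le> pos \<nu> k" "pos \<nu> k < int ?n"
    using pos_bounds[OF \<nu>] by auto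
  have dvd: "int ?n dvd pos \<nu> j + pos \<nu> k
      \<longleftrightarrow> pos \<nu> j + pos \<nu> k = 0 \<or> pos \<nu> j + pos \<nu> k = int ?n"
  proof
    assume "int ?n dvd pos \<nu> j + pos \<nu> k"
    then obtain t where t: "pos \<nu> j + pos \<nu> k = int ?n * t" ..
    with bounds have "int ?n * t \<ge> 0" "int ?n * t < int ?n * 2" by linarith+
    then have "t \<ge> 0" "t < 2" by (auto simp: zero_le_mult_iff)
    then have "t = 0 \<or> t = 1" by auto
    with t show "pos \<nu> j + pos \<nu> k = 0 \<or> pos \<nu> j + pos \<nu> k = int ?n" by auto
  qed auto
  have S: "(\<Sum>i=1..?n. character ?n ((int ?n + 1 - int (\<nu> j)) * (1 - int i)) *\<^sub>C T i x) = ?S"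
  proof (rule sum.reindex_bij_witness[where i = "\<lambda>r. nat r + 1" and j = "\<lambda>i. int i - 1"])
    fix i assume i: "i \<in> {1..?n}"
    have "character ?n (pos \<nu> j * (int i - 1))
        = character ?n ((int ?n + 1 - int (\<nu> j)) * (1 - int i))"
    proof (rule character_cong)
      have "(int ?n + 1 - int (\<nu> j)) * (1 - int i) = int ?n * (1 - int i) + pos \<nu> j * (int i - 1)"
        by (simp add: pos_def algebra_simps)
      then show "pos \<nu> j * (int i - 1) mod int ?n
          = (int ?n + 1 - int (\<nu> j)) * (1 - int i) mod int ?n" by simp
    qed simp
    moreover have "periodic_ops ?n T (int i - 1) = T i"
      using i by (simp add: periodic_ops_def nat_diff_distrib)
    ultimately show "character ?n (pos \<nu> j * (int i - 1)) *\<^sub>C periodic_ops ?n T (int i - 1) x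
        = character ?n ((int ?n + 1 - int (\<nu> j)) * (1 - int i)) *\<^sub>C T i x" by simp
  qed auto
  consider (first) "\<nu> j = 1 \<and> \<nu> k = 1"
    | (anti) "\<not> (\<nu> j = 1 \<and> \<nu> k = 1)" "2 \<le> \<nu> j \<and> \<nu> k = ?n + 2 - \<nu> j"
    | (off) "\<not> (\<nu> j = 1 \<and> \<nu> k = 1)" "\<not> (2 \<le> \<nu> j \<and> \<nu> k = ?n + 2 - \<nu> j)"
    by blast
  then show ?thesis
  proof cases
    case first
    \<comment> \<open>here \<open>n + 1 - \<nu> j = n\<close>, so that all the characters in \<open>S\<close> are trivial\<close>
    then have "character ?n ((int ?n + 1 - int (\<nu> j)) * (1 - int i)) = 1" for i
      by (simp add: character_eq_1_iff)
    with first S show ?thesis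
      by (simp add: lcirc_D_def Let_def dvd pos_def)
  next
    case anti
    then have "int ?n dvd pos \<nu> j + pos \<nu> k"
      using bounds unfolding dvd by (auto simp: pos_def)
    with anti S show ?thesis
      by (auto simp: lcirc_D_def Let_def root_of_unity_powi)
  next
    case off
    then have "\<not> int ?n dvd pos \<nu> j + pos \<nu> k"
      using bounds unfolding dvd by (auto simp: pos_def)
    with off show ?thesis
      by (auto simp: lcirc_D_def Let_def)
  qed
qed

text \<open>
  Row \<open>m\<close> can be nonzero only in column \<open>- m\<close> modulo \<open>n\<close>.
\<close>

lemma periodic_seq_lcirc_D:
  fixes x :: "'a::complex_inner ^ 'n::finite"
  assumes \<nu>: "numbering \<nu>"
  shows "periodic_seq \<nu> (opmat_apply (lcirc_D \<nu> T) x) m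
    = (\<Sum>r\<in>{0..<int CARD('n)}. character CARD('n) (m * r) *\<^sub>C
        periodic_ops CARD('n) T r (periodic_seq \<nu> x (- m)))"
    (is "_ = ?f m")
proof (rule periodic_seq_eqI[OF \<nu>, where f = ?f])
  let ?n = "CARD('n)"
  fix m
  have "periodic_seq \<nu> x (- (m mod int ?n)) = periodic_seq \<nu> x (- m)"
    by (metis mod_minus_eq periodic_seq_mod)
  moreover have "character ?n (m mod int ?n * r) = character ?n (m * r)" for r
    by (rule character_cong) (simp_all add: mod_simps)
  ultimately show "?f (m mod int ?n) = ?f m" by simp
next
  let ?n = "CARD('n)"
  fix j
  let ?g = "\<lambda>q. if int ?n dvd pos \<nu> j + q
    then \<Sum>r\<in>{0..<int ?n}. character ?n (pos \<nu> j * r) *\<^sub>C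
      periodic_ops ?n T r (periodic_seq \<nu> x q) else 0"
  have "opmat_apply (lcirc_D \<nu> T) x $ j = (\<Sum>k\<in>UNIV. ?g (pos \<nu> k))"
    by (simp add: opmat_apply_def lcirc_D_entry[OF \<nu>] periodic_seq_pos[OF \<nu>] cong: if_cong)
  also have "\<dots> = (\<Sum>q\<in>{0..<int ?n}. ?g q)"
    by (rule sum_pos[OF \<nu>])
  also have "\<dots> = (\<Sum>q\<in>{0..<int ?n}. if q = - pos \<nu> j mod int ?n then ?f (pos \<nu> j) else 0)"
  proof (rule sum.cong[OF refl])
    fix q assume q: "q \<in> {0..<int ?n}"
    have "int ?n dvd pos \<nu> j + q \<longleftrightarrow> q mod int ?n = - pos \<nu> j mod int ?n"
      by (simp add: mod_eq_dvd_iff add.commute)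
    also have "\<dots> \<longleftrightarrow> q = - pos \<nu> j mod int ?n"
      using q by simp
    finally show "?g q = (if q = - pos \<nu> j mod int ?n then ?f (pos \<nu> j) else 0)"
      by (simp add: periodic_seq_mod)
  qed
  also have "\<dots> = ?f (pos \<nu> j)"
    by simp
  finally show "opmat_apply (lcirc_D \<nu> T) x $ j = ?f (pos \<nu> j)" .
qed

section \<open>Block diagonalisation of left circulants\<close>

text \<open>
  The transform turns the correlation performed by the circulant into a product, evaluated at the
  reflected frequency.  The sign \<open>- 1\<close> fits because the sum over \<open>b\<close> in the circulant is matched
  with the sum over \<open>q = - b\<close> in the transform of the second matrix, where the characters \<open>\<omega>^(q r)\<close>
  then become \<open>\<omega>^(- r b)\<close>.
\<close>

lemma lcirc_fourier:
  fixes x :: "'a::complex_inner ^ 'n::finite"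
  assumes \<nu>: "numbering \<nu>"
    and lin: "\<And>i. i \<in> {1..CARD('n)} \<Longrightarrow> bounded_clinear (T i)"
  shows "opmat_apply (lcirc \<nu> T) (fourier (- 1) \<nu> x)
    = fourier (- 1) \<nu> (opmat_apply (lcirc_D \<nu> T) x)"
proof (rule vec_eq_iff[THEN iffD2, rule_format])
  fix j
  let ?n = "CARD('n)" and ?c = "complex_of_real (1 / sqrt (real CARD('n)))"
  let ?S = "periodic_ops CARD('n) T" and ?y = "periodic_seq \<nu> x" and ?p = "pos \<nu> j"
  let ?g = "\<lambda>b. \<Sum>r\<in>{0..<int ?n}. character ?n ((?p - r) * b) *\<^sub>C ?S r (?y b)"
  have S: "bounded_clinear (?S r)" for r
  proof -
    have "nat (r mod int ?n) < ?n" by (simp add: nat_less_iff)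
    then show ?thesis unfolding periodic_ops_def by (intro lin) auto
  qed
  have "opmat_apply (lcirc \<nu> T) (fourier (- 1) \<nu> x) $ j
      = (\<Sum>r\<in>{0..<int ?n}. ?S r (?c *\<^sub>C (\<Sum>b\<in>{0..<int ?n}.
          character ?n (- 1 * (r - ?p) * b) *\<^sub>C ?y b)))"
    unfolding opmat_apply_lcirc[OF \<nu>] periodic_seq_fourier[OF \<nu>] ..
  also have "\<dots> = ?c *\<^sub>C (\<Sum>r\<in>{0..<int ?n}. \<Sum>b\<in>{0..<int ?n}.
      character ?n ((?p - r) * b) *\<^sub>C ?S r (?y b))"
    by (simp add: bounded_clinear_scaleC[OF S] bounded_clinear_sum[OF S] scaleC_sum_right)
  also have "\<dots> = ?c *\<^sub>C (\<Sum>b\<in>{0..<int ?n}. ?g b)"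
    by (subst sum.swap) (rule refl)
  also have "(\<Sum>b\<in>{0..<int ?n}. ?g b) = (\<Sum>q\<in>{0..<int ?n}. ?g (- q))"
  proof (rule sum_residues_reflect[symmetric])
    fix m
    have "character ?n ((?p - r) * (m mod int ?n)) = character ?n ((?p - r) * m)" for r
      by (rule character_cong) (simp_all add: mod_simps)
    then show "?g (m mod int ?n) = ?g m"
      by (simp add: periodic_seq_mod)
  qed simp
  also have "\<dots> = (\<Sum>q\<in>{0..<int ?n}. character ?n (- 1 * ?p * q) *\<^sub>C
      (\<Sum>r\<in>{0..<int ?n}. character ?n (q * r) *\<^sub>C ?S r (?y (- q))))"
    by (simp add: scaleC_sum_right scaleC_scaleC algebra_simps flip: character_add)
  also have "?c *\<^sub>C \<dots> = periodic_seq \<nu> (fourier (- 1) \<nu> (opmat_apply (lcirc_D \<nu> T) x)) ?p"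
    unfolding periodic_seq_fourier[OF \<nu>] periodic_seq_lcirc_D[OF \<nu>] ..
  finally show "opmat_apply (lcirc \<nu> T) (fourier (- 1) \<nu> x) $ j
      = fourier (- 1) \<nu> (opmat_apply (lcirc_D \<nu> T) x) $ j"
    by (simp add: periodic_seq_pos[OF \<nu>])
qed

theorem theorem3p1:
  fixes A :: "'a::chilbert_space \<Rightarrow> 'a"
    and T :: "nat \<Rightarrow> 'a \<Rightarrow> 'a"
    and \<nu> :: "'n::finite \<Rightarrow> nat"
  assumes "positive_op A"
    and "numbering \<nu>"
    and "\<And>i. i \<in> {1..CARD('n)} \<Longrightarrow> T i \<in> B_A A"
  shows "A_numerical_radius (opmat_apply (block_diag A)) (opmat_apply (lcirc \<nu> T))
       = A_numerical_radius (opmat_apply (block_diag A)) (opmat_apply (lcirc_D \<nu> T))"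
proof (rule A_numerical_radius_unitarily_equivalent)
  let ?U = "fourier (- 1) \<nu> :: 'a ^ 'n \<Rightarrow> 'a ^ 'n"
  show "surj ?U"
    using fourier_inverse[OF assms(2), of 1] by (metis abs_one surjI)
  show "cinner (?U x) (?U y) = cinner x y" for x y
    unfolding cinner_fourier_left using fourier_inverse[OF assms(2), of "- 1" y] by simp
  show "opmat_apply (block_diag A) (?U x) = ?U (opmat_apply (block_diag A) x)" for x
    using assms(1) by (intro block_diag_fourier) (simp add: positive_op_def)
  show "opmat_apply (lcirc \<nu> T) (?U x) = ?U (opmat_apply (lcirc_D \<nu> T) x)" for x
    using assms(3) by (intro lcirc_fourier[OF assms(2)]) (simp add: B_A_def)
qed

end
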